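(* Let $G=(V,E)$ be a hypergraph and let $OPT_k$ be the value of a minimum $k$-cut in $G$ for some integer $k\ge2$. Suppose $(U,\overline U)$ is a 2-partition of $V$ with $d(U)\le OPT_k$. Then there exists a subset $S\subseteq U$ with $|S|\le 2k-2$ such that $(U,\overline U)$ is the source maximal minimum $(S,\overline U)$-terminal cut in $G$.
   Context: A hypergraph $G=(V,E)$ has finite vertex set $V$ and finite multiset $E$ of unit-cost hyperedges (subsets of $V$). For $X\subseteq V$, $\overline X=V\setminus X$ and $d(X)$ is the number of hyperedges meeting both $X$ and $\overline X$. $OPT_k$ is the minimum, over all partitions of $V$ into $k$ non-empty parts, of the number of hyperedges meeting at least two parts. For disjoint $S,T\subseteq V$, a 2-partition $(X,\overline X)$ is an $(S,T)$-terminal cut if $S\subseteq X\subseteq V\setminus T$; it is minimum if $d(X)$ is minimum among such cuts; the source maximal minimum $(S,T)$-terminal cut is the unique minimum one whose source set $X$ is inclusion-wise maximal. *)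

theory Defs
  imports Main "HOL-Library.Multiset" "HOL-Library.Disjoint_Sets"
begin

definition hypergraph :: "'a set \<Rightarrow> 'a set multiset \<Rightarrow> bool" where
  "hypergraph V E \<longleftrightarrow> finite V \<and> (\<forall>e \<in># E. e \<subseteq> V)"

definition cut_value :: "'a set \<Rightarrow> 'a set multiset \<Rightarrow> 'a set \<Rightarrow> nat" where
  "cut_value V E X = size (filter_mset (\<lambda>e. e \<inter> X \<noteq> {} \<and> e \<inter> (V - X) \<noteq> {}) E)"

definition partition_cost :: "'a set multiset \<Rightarrow> 'a set set \<Rightarrow> nat" where
  "partition_cost E P =
     size (filter_mset (\<lambda>e. \<exists>X\<in>P. \<exists>Y\<in>P. X \<noteq> Y \<and> e \<inter> X \<noteq> {} \<and> e \<inter> Y \<noteq> {}) E)"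

definition OPT :: "'a set \<Rightarrow> 'a set multiset \<Rightarrow> nat \<Rightarrow> nat" where
  "OPT V E k = Min {partition_cost E P | P. partition_on V P \<and> card P = k}"

definition terminal_cut :: "'a set \<Rightarrow> 'a set \<Rightarrow> 'a set \<Rightarrow> 'a set \<Rightarrow> bool" where
  "terminal_cut V S T X \<longleftrightarrow> S \<subseteq> X \<and> X \<subseteq> V - T"

definition min_terminal_cut ::
  "'a set \<Rightarrow> 'a set multiset \<Rightarrow> 'a set \<Rightarrow> 'a set \<Rightarrow> 'a set \<Rightarrow> bool" where
  "min_terminal_cut V E S T X \<longleftrightarrow> terminal_cut V S T X \<and>
     (\<forall>Y. terminal_cut V S T Y \<longrightarrow> cut_value V E X \<le> cut_value V E Y)"

text \<open>The source maximal minimum (S,T)-terminal cut: the minimum terminal cut whose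
  source set contains the source set of every minimum terminal cut (this is the
  unique minimum cut with inclusion-wise maximal source set).\<close>
definition source_max_min_terminal_cut ::
  "'a set \<Rightarrow> 'a set multiset \<Rightarrow> 'a set \<Rightarrow> 'a set \<Rightarrow> 'a set \<Rightarrow> bool" where
  "source_max_min_terminal_cut V E S T X \<longleftrightarrow> min_terminal_cut V E S T X \<and>
     (\<forall>Y. min_terminal_cut V E S T Y \<longrightarrow> Y \<subseteq> X)"

end

theory Submission
  imports Defs
begin

text \<open>
  Write \<open>T = V - U\<close> and take a minimal \<open>S \<subseteq> U\<close> for which \<open>U\<close> is a minimum \<open>(S, T)\<close>-terminal cut.
  By minimality every \<open>s \<in> S\<close> has a set \<open>A s \<supseteq> T\<close> with \<open>A s \<inter> S = {s}\<close> and \<open>d (A s) < d U\<close>.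
  Starting from \<open>Z = T\<close>, \<open>W = U\<close>, the sets \<open>A s\<close> are inserted one by one into a partition of \<open>V\<close>
  into classes \<open>X s\<close>, \<open>Z\<close> and \<open>W\<close>: inserting \<open>C = A t\<close> splits off the new class \<open>X t = W \<inter> C\<close> and
  moves \<open>X s \<inter> C\<close> to \<open>Z\<close>. Give a hyperedge weight 2 if it meets two of the classes \<open>X s\<close> or both \<open>W\<close>
  and \<open>Z\<close>, and weight 1 if it crosses the partition in another way. The total weight is \<open>2 d U\<close>
  initially, and each insertion changes it by at most \<open>d C - d (C \<inter> Z) < 0\<close>, since
  \<open>d (C \<inter> Z) \<ge> d U\<close>. If \<open>|S| \<ge> 2k - 2\<close>, insert \<open>2k - 2\<close> sets and split the resulting \<open>X s\<close>
  into two groups of \<open>k - 1\<close> classes. Each group together with the complement of its union is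
  a \<open>k\<close>-partition, and the two costs add up to at most the total weight, hence to less than
  \<open>2 OPT k\<close>, which is impossible.
\<close>

section \<open>Hyperedge weights relative to a family of classes\<close>

definition meets_two :: "('i \<Rightarrow> 'a set) \<Rightarrow> 'i set \<Rightarrow> 'a set \<Rightarrow> bool" where
  "meets_two X I e \<longleftrightarrow> (\<exists>i\<in>I. \<exists>j\<in>I. i \<noteq> j \<and> e \<inter> X i \<noteq> {} \<and> e \<inter> X j \<noteq> {})"

text \<open>The class \<open>W\<close> is not a parameter: it is whatever \<open>Z\<close> and the
  sets \<open>X i\<close> leave over in \<open>V\<close>.\<close>

definition heavy :: "'a set \<Rightarrow> ('i \<Rightarrow> 'a set) \<Rightarrow> 'i set \<Rightarrow> 'a set \<Rightarrow> 'a set \<Rightarrow> bool" where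
  "heavy V X I Z e \<longleftrightarrow> meets_two X I e \<or> e \<inter> (V - Z - \<Union>(X ` I)) \<noteq> {} \<and> e \<inter> Z \<noteq> {}"

definition crossing :: "'a set \<Rightarrow> ('i \<Rightarrow> 'a set) \<Rightarrow> 'i set \<Rightarrow> 'a set \<Rightarrow> 'a set \<Rightarrow> bool" where
  "crossing V X I Z e \<longleftrightarrow> heavy V X I Z e \<or> e \<inter> \<Union>(X ` I) \<noteq> {} \<and> e \<inter> (V - \<Union>(X ` I)) \<noteq> {}"

text \<open>Since \<open>heavy\<close> implies \<open>crossing\<close>, the two indicators are the
  thresholds 2 and 1 of the weight, so comparing weights reduces to Boolean implications.\<close>

definition weight :: "'a set \<Rightarrow> ('i \<Rightarrow> 'a set) \<Rightarrow> 'i set \<Rightarrow> 'a set \<Rightarrow> 'a set \<Rightarrow> nat" where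
  "weight V X I Z e = of_bool (heavy V X I Z e) + of_bool (crossing V X I Z e)"

definition cuts :: "'a set \<Rightarrow> 'a set \<Rightarrow> 'a set \<Rightarrow> bool" where
  "cuts V A e \<longleftrightarrow> e \<inter> A \<noteq> {} \<and> e \<inter> (V - A) \<noteq> {}"

lemma size_filter_mset_eq_sum: "size (filter_mset P M) = (\<Sum>e\<in>#M. of_bool (P e))"
  by (induction M) auto

lemma cut_value_eq_sum: "cut_value V E A = (\<Sum>e\<in>#E. of_bool (cuts V A e))"
  by (simp add: cut_value_def cuts_def size_filter_mset_eq_sum)

lemma cut_value_compl: "A \<subseteq> V \<Longrightarrow> cut_value V E (V - A) = cut_value V E A"
  by (simp add: cut_value_def double_diff conj_commute)

text \<open>The effect of one insertion on a single hyperedge, in the manner of an uncrossing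
  inequality. Summed over \<open>E\<close> it bounds the growth of the total weight by
  \<open>d C - d (C \<inter> Z)\<close>.\<close>

lemma weight_insert_le:
  fixes X :: "'i \<Rightarrow> 'a set"
  assumes e: "e \<subseteq> V" and t: "t \<notin> I"
    and disj: "\<And>i. i \<in> I \<Longrightarrow> X i \<inter> Z = {}"
    and X': "X' = (\<lambda>i. if i = t then C \<inter> (V - Z - \<Union>(X ` I)) else X i - C)"
    and Z': "Z' = Z \<union> C \<inter> \<Union>(X ` I)"
  shows "weight V X' (insert t I) Z' e + of_bool (cuts V (C \<inter> Z) e)
         \<le> weight V X I Z e + of_bool (cuts V C e)"
proof -
  define Q where "Q = \<Union>(X ` I)"
  let ?W = "V - Z - Q"
  let ?h = "heavy V X I Z e" and ?c = "crossing V X I Z e"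
  let ?h' = "heavy V X' (insert t I) Z' e" and ?c' = "crossing V X' (insert t I) Z' e"
  let ?C = "cuts V C e" and ?D = "cuts V (C \<inter> Z) e"
  let ?m = "meets_two X I e" and ?m' = "meets_two X' (insert t I) e"
  have QZ: "Q \<inter> Z = {}"
    using disj by (auto simp: Q_def)
  have UX': "\<Union>(X' ` insert t I) = C \<inter> ?W \<union> (Q - C)"
    unfolding X' Q_def using t by (auto split: if_splits)
  have W': "V - Z' - \<Union>(X' ` insert t I) = ?W - C"
    unfolding UX' Z' Q_def by auto
  \<comment> \<open>Among the new classes only \<open>X' t\<close> lies in \<open>C\<close>; the
    others are old ones trimmed to \<open>Q - C\<close>. Hence a hyperedge meeting two of them
    always reaches \<open>Q - C\<close>.\<close>
  have m': "?m \<and> e \<inter> (Q - C) \<noteq> {} \<or> e \<inter> (C \<inter> ?W) \<noteq> {} \<and> e \<inter> (Q - C) \<noteq> {}" if mm: "?m'"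
  proof -
    obtain i j where ij: "i \<in> insert t I" "j \<in> insert t I" "i \<noteq> j"
      "e \<inter> X' i \<noteq> {}" "e \<inter> X' j \<noteq> {}"
      using mm unfolding meets_two_def by blast
    have new: "e \<inter> (C \<inter> ?W) \<noteq> {}" if "e \<inter> X' t \<noteq> {}"
      using that by (simp add: X' Q_def)
    have old: "e \<inter> X s \<noteq> {}" "e \<inter> (Q - C) \<noteq> {}" "s \<in> I"
      if s: "s \<in> insert t I" "s \<noteq> t" "e \<inter> X' s \<noteq> {}" for s
    proof -
      show "s \<in> I"
        using s by simp
      moreover have "e \<inter> (X s - C) \<noteq> {}"
        using s by (simp add: X')
      ultimately show "e \<inter> X s \<noteq> {}" "e \<inter> (Q - C) \<noteq> {}"
        unfolding Q_def by blast+
    qed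
    show ?thesis
    proof (cases "i = t \<or> j = t")
      case True
      then show ?thesis
        using old(2)[of i] old(2)[of j] ij new by metis
    next
      case False
      then have "?m"
        unfolding meets_two_def using old(1,3)[of i] old(1,3)[of j] ij by metis
      then show ?thesis
        using False old(2)[of i] ij by metis
    qed
  qed
  have m: "e \<inter> Q \<noteq> {}" if "?m"
    using that unfolding meets_two_def Q_def by blast
  have h_iff: "?h \<longleftrightarrow> ?m \<or> e \<inter> ?W \<noteq> {} \<and> e \<inter> Z \<noteq> {}"
    by (simp add: heavy_def Q_def)
  have c_iff: "?c \<longleftrightarrow> ?h \<or> e \<inter> Q \<noteq> {} \<and> e \<inter> (V - Q) \<noteq> {}"
    by (simp add: crossing_def Q_def)
  have h'_iff: "?h' \<longleftrightarrow> ?m' \<or> e \<inter> (?W - C) \<noteq> {} \<and> e \<inter> (Z \<union> C \<inter> Q) \<noteq> {}"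
    unfolding heavy_def W' by (simp add: Z' Q_def)
  have c'_iff: "?c' \<longleftrightarrow> ?h' \<or>
      e \<inter> (C \<inter> ?W \<union> (Q - C)) \<noteq> {} \<and> e \<inter> (V - (C \<inter> ?W \<union> (Q - C))) \<noteq> {}"
    unfolding crossing_def UX' ..
  have hc: "?h \<Longrightarrow> ?c" and hc': "?h' \<Longrightarrow> ?c'"
    by (auto simp: crossing_def)
  \<comment> \<open>\<open>?D\<close> puts a vertex of \<open>e\<close> in
    \<open>C \<inter> Z\<close>, while \<open>?h'\<close> always puts one outside \<open>C\<close>,
    in \<open>Q - C\<close> or \<open>?W - C\<close>. If \<open>?m\<close> fails, \<open>e\<close>
    also meets \<open>?W\<close> and thus joins \<open>?W\<close> to \<open>Z\<close>.\<close>
  have h'D: "?h \<and> ?C" if "?h'" "?D"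
    using that m' e unfolding h'_iff h_iff cuts_def by blast
  have h': "?h \<or> ?c \<and> ?C" if "?h'"
    using that m' e QZ unfolding h'_iff c_iff h_iff cuts_def by blast
  have split': "?h' \<or> e \<inter> (C \<inter> ?W) \<noteq> {} \<or> e \<inter> (Q - C) \<noteq> {}" if "?c'"
    using that unfolding c'_iff by blast
  have c'D: "?h \<or> ?c \<and> ?C" if "?c'" "?D"
  proof -
    have Z: "e \<inter> (C \<inter> Z) \<noteq> {}"
      using \<open>?D\<close> by (simp add: cuts_def)
    consider "?h'" | "e \<inter> (C \<inter> ?W) \<noteq> {}" | "e \<inter> (Q - C) \<noteq> {}"
      using split' \<open>?c'\<close> by blast
    then show ?thesis
    proof cases
      case 1
      then show ?thesis
        using h' by blast
    next
      case 2
      then show ?thesis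
        using Z unfolding h_iff by blast
    next
      case 3
      then have "e \<inter> Q \<noteq> {}" "e \<inter> (V - Q) \<noteq> {}" "e \<inter> C \<noteq> {}" "e \<inter> (V - C) \<noteq> {}"
        using Z e QZ by blast+
      then show ?thesis
        unfolding c_iff cuts_def by blast
    qed
  qed
  \<comment> \<open>If both fail, all vertices of \<open>e\<close> lie on the same side of
    \<open>C\<close> and of \<open>Q\<close>, and \<open>e\<close> cannot join \<open>?W\<close> to
    \<open>Z\<close>; so \<open>e\<close> cannot leave the union of the new classes.\<close>
  have c': "?c \<or> ?C" if "?c'"
  proof (rule ccontr)
    assume no: "\<not> ?thesis"
    then have "\<not> ?h'"
      using h' hc by blast
    then obtain v w where v: "v \<in> e" "v \<in> C \<inter> ?W \<or> v \<in> Q - C"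
      and w: "w \<in> e" "w \<notin> C \<inter> ?W" "w \<notin> Q - C"
      using \<open>?c'\<close> unfolding c'_iff by blast
    have "v \<in> C \<longleftrightarrow> w \<in> C" "v \<in> Q \<longleftrightarrow> w \<in> Q"
      using no v(1) w(1) e unfolding c_iff cuts_def by blast+
    moreover have "v \<in> ?W \<longrightarrow> w \<notin> Z"
      using no v(1) w(1) unfolding c_iff h_iff by blast
    moreover have "w \<in> V"
      using w(1) e by blast
    ultimately show False
      using v(2) w(2,3) by blast
  qed
  have D: "?c \<or> ?C" if "?D"
    using that e QZ unfolding c_iff h_iff cuts_def by blast
  show ?thesis
    \<comment> \<open>For each \<open>n\<close> up to 3, if \<open>n\<close> of the indicators on
      the left hold, then at least \<open>n\<close> on the right do: \<open>h'D\<close> serves 3,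
      \<open>h'\<close> and \<open>c'D\<close> serve 2, \<open>c'\<close> and \<open>D\<close> serve
      1.\<close>
    using hc hc' h'D h' c'D c' D unfolding weight_def of_bool_def
    by (cases ?h; cases ?c; cases ?h'; cases ?c'; cases ?C; cases ?D) simp_all
qed

section \<open>Iterated uncrossing\<close>

text \<open>The elements of \<open>S\<close> serve as markers: \<open>i\<close> stays in
  \<open>X i\<close>, which keeps that class non-empty, and \<open>Z\<close> avoids all of
  \<open>S\<close>, so that \<open>min\<close> applies to its intersection with the next set. Each
  strict inequality \<open>cut_value V E (A s) < c\<close> gains 1, which accounts for
  \<open>card I\<close>.\<close>

lemma uncross_family:
  fixes S :: "'a set"
  assumes "finite I" and hyp: "hypergraph V E" and T: "T \<subseteq> V" and "I \<subseteq> S" and TS: "T \<inter> S = {}"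
    and A: "\<And>s. s \<in> I \<Longrightarrow> T \<subseteq> A s \<and> A s \<subseteq> V \<and> A s \<inter> S = {s} \<and> cut_value V E (A s) < c"
    and min: "\<And>D. T \<subseteq> D \<Longrightarrow> D \<subseteq> V \<Longrightarrow> D \<inter> S = {} \<Longrightarrow> c \<le> cut_value V E D"
    and c: "c = cut_value V E T"
  shows "\<exists>X Z. T \<subseteq> Z \<and> Z \<subseteq> V \<and> Z \<inter> S = {} \<and> (\<forall>i\<in>I. X i \<subseteq> V \<and> X i \<inter> S = {i} \<and> X i \<inter> Z = {}) \<and>
    disjoint_family_on X I \<and> (\<Sum>e\<in>#E. weight V X I Z e) + card I \<le> 2 * c"
  using assms(1,4) A
proof (induction I rule: finite_induct)
  case empty
  \<comment> \<open>Without classes \<open>X i\<close> only \<open>T\<close> and its complement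
    remain, so every crossing hyperedge is heavy.\<close>
  have "weight V (\<lambda>_::'a. {}) {} T = (\<lambda>e. 2 * of_bool (cuts V T e))"
    by (auto simp: weight_def crossing_def heavy_def meets_two_def cuts_def)
  then have "(\<Sum>e\<in>#E. weight V (\<lambda>_::'a. {}) {} T e) = 2 * c"
    by (simp add: c cut_value_eq_sum sum_mset_distrib_left)
  then show ?case
    using T TS by (intro exI[of _ "\<lambda>_. {}"] exI[of _ T]) (simp add: disjoint_family_on_def)
next
  case (insert t I)
  have IS: "I \<subseteq> S"
    and AI: "\<And>s. s \<in> I \<Longrightarrow> T \<subseteq> A s \<and> A s \<subseteq> V \<and> A s \<inter> S = {s} \<and> cut_value V E (A s) < c"
    using insert.prems by auto
  obtain X Z where XZ0: "T \<subseteq> Z" "Z \<subseteq> V" "Z \<inter> S = {}"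
    "\<forall>i\<in>I. X i \<subseteq> V \<and> X i \<inter> S = {i} \<and> X i \<inter> Z = {}" "disjoint_family_on X I"
    and w: "(\<Sum>e\<in>#E. weight V X I Z e) + card I \<le> 2 * c"
    using insert.IH[OF IS AI] by blast
  have XZ: "T \<subseteq> Z" "Z \<subseteq> V" "Z \<inter> S = {}"
    "\<And>i. i \<in> I \<Longrightarrow> X i \<subseteq> V" "\<And>i. i \<in> I \<Longrightarrow> X i \<inter> S = {i}" "\<And>i. i \<in> I \<Longrightarrow> X i \<inter> Z = {}"
    "disjoint_family_on X I"
    using XZ0 by simp_all
  define C where "C = A t"
  have C: "T \<subseteq> C" "C \<subseteq> V" "C \<inter> S = {t}" "cut_value V E C < c"
    using insert.prems(2)[of t] by (auto simp: C_def)
  define X' where "X' = (\<lambda>i. if i = t then C \<inter> (V - Z - \<Union>(X ` I)) else X i - C)"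
  define Z' where "Z' = Z \<union> C \<inter> \<Union>(X ` I)"
  have X't: "X' t = C \<inter> (V - Z - \<Union>(X ` I))"
    by (simp add: X'_def)
  have X'I: "X' i = X i - C" if "i \<in> I" for i
    using that insert.hyps by (auto simp: X'_def)
  have ti: "t \<in> S" "t \<notin> Z" "t \<in> C" "t \<in> V"
    using C insert.prems(1) XZ(3) by auto
  have tX: "t \<notin> X i" if "i \<in> I" for i
    using XZ(5)[OF that] ti insert.hyps(2) that by auto
  have iC: "i \<notin> C" "i \<in> X i" if "i \<in> I" for i
  proof -
    have "i \<in> S" "i \<noteq> t"
      using IS that insert.hyps(2) by auto
    then show "i \<notin> C" "i \<in> X i"
      using XZ(5)[OF that] C(3) by auto
  qed
  have "(\<Sum>e\<in>#E. weight V X' (insert t I) Z' e + of_bool (cuts V (C \<inter> Z) e))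
      \<le> (\<Sum>e\<in>#E. weight V X I Z e + of_bool (cuts V C e))"
    using hyp weight_insert_le[OF _ insert.hyps(2) XZ(6) X'_def Z'_def]
    by (intro sum_mset_mono) (auto simp: hypergraph_def)
  then have "(\<Sum>e\<in>#E. weight V X' (insert t I) Z' e) + cut_value V E (C \<inter> Z)
      \<le> (\<Sum>e\<in>#E. weight V X I Z e) + cut_value V E C"
    by (simp add: cut_value_eq_sum sum_mset.distrib)
  \<comment> \<open>\<open>C \<inter> Z\<close> contains \<open>T\<close>, and it avoids
    \<open>S\<close> because \<open>Z\<close> does.\<close>
  moreover have "c \<le> cut_value V E (C \<inter> Z)"
    using C XZ by (intro min) auto
  ultimately have w': "(\<Sum>e\<in>#E. weight V X' (insert t I) Z' e) + card (insert t I) \<le> 2 * c"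
    using w C(4) insert.hyps by simp
  have "T \<subseteq> Z'" "Z' \<subseteq> V"
    using XZ C by (auto simp: Z'_def)
  moreover have "Z' \<inter> S = {}"
  proof -
    \<comment> \<open>The part moved into \<open>Z\<close> comes from \<open>C\<close>, whose only
      marker \<open>t\<close> lies in none of the old classes.\<close>
    have "v = t" if "v \<in> C" "v \<in> S" for v
      using C(3) that by blast
    then show ?thesis
      using XZ(3) tX by (auto simp: Z'_def)
  qed
  moreover have "X' i \<subseteq> V \<and> X' i \<inter> S = {i} \<and> X' i \<inter> Z' = {}" if "i \<in> insert t I" for i
  proof (cases "i = t")
    case True
    have "X' t \<inter> S = {t}"
    proof
      show "X' t \<inter> S \<subseteq> {t}"
        using C(3) unfolding X't by blast
      show "{t} \<subseteq> X' t \<inter> S"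
        using ti tX by (simp add: X't)
    qed
    moreover have "X' t \<subseteq> V" "X' t \<inter> Z' = {}"
      unfolding X't Z'_def by blast+
    ultimately show ?thesis
      using True by simp
  next
    case False
    then have i: "i \<in> I"
      using that by simp
    have "X' i \<inter> S = {i}"
      using XZ(5)[OF i] iC[OF i] unfolding X'I[OF i] by blast
    moreover have "X' i \<subseteq> V" "X' i \<inter> Z' = {}"
      using XZ(4,6)[OF i] unfolding X'I[OF i] Z'_def by blast+
    ultimately show ?thesis
      by simp
  qed
  moreover have "disjoint_family_on X' (insert t I)"
  proof -
    have "X' i \<inter> X' t = {}" if "i \<in> I" for i
      using that unfolding X'I[OF that] X't by blast
    moreover have "X' i \<inter> X' j = {}" if "i \<in> I" "j \<in> I" "i \<noteq> j" for i j
      using that XZ(7) unfolding X'I[OF that(1)] X'I[OF that(2)] disjoint_family_on_def by blast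
    ultimately show ?thesis
      unfolding disjoint_family_on_def by (metis Int_commute insertE)
  qed
  ultimately show ?case
    using w' by (intro exI[of _ X'] exI[of _ Z'] conjI ballI) simp_all
qed

section \<open>From groups of classes to k-partitions\<close>

lemma OPT_le_partition_cost:
  assumes "finite V" "partition_on V P" "card P = k"
  shows "OPT V E k \<le> partition_cost E P"
proof -
  have "{partition_cost E P | P. partition_on V P \<and> card P = k} \<subseteq> {..size E}"
    by (auto simp: partition_cost_def intro: size_mset_mono)
  then show ?thesis
    unfolding OPT_def using assms by (intro Min_le) (auto intro: finite_subset)
qed

text \<open>The complement of the union of the group is the extra part counted by
  \<open>Suc\<close>.\<close>

lemma OPT_le_group_cost:
  assumes "finite V" "finite J" "disjoint_family_on X J" "\<And>i. i \<in> J \<Longrightarrow> X i \<subseteq> V \<and> X i \<noteq> {}"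
    and "\<Union>(X ` J) \<noteq> V"
  shows "OPT V E (Suc (card J)) \<le>
    size (filter_mset (\<lambda>e. meets_two X J e \<or> cuts V (\<Union>(X ` J)) e) E)"
proof -
  let ?R = "V - \<Union>(X ` J)"
  let ?P = "insert ?R (X ` J)"
  have part: "partition_on V ?P"
  proof (rule partition_onI)
    have "\<Union>(X ` J) \<subseteq> V"
      using assms(4) by blast
    then show "\<Union>?P = V"
      by auto
    have "?R \<noteq> {}"
      using \<open>\<Union>(X ` J) \<subseteq> V\<close> assms(5) by blast
    moreover have "{} \<notin> X ` J"
      using assms(4) by auto
    ultimately show "{} \<notin> ?P"
      by (metis insertE)
    have "disjnt (X i) (X j)" if "i \<in> J" "j \<in> J" "X i \<noteq> X j" for i j
      using that assms(3) unfolding disjnt_def disjoint_family_on_def by metis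
    moreover have "disjnt ?R (X i)" "disjnt (X i) ?R" if "i \<in> J" for i
      using that by (auto simp: disjnt_def)
    ultimately show "disjnt p q" if "p \<in> ?P" "q \<in> ?P" "p \<noteq> q" for p q
      using that by (elim insertE imageE) simp_all
  qed
  have inj: "inj_on X J"
    using assms(3,4) unfolding inj_on_def disjoint_family_on_def by (metis Int_absorb)
  have "X i \<noteq> ?R" if "i \<in> J" for i
    using assms(4)[OF that] that by blast
  then have "?R \<notin> X ` J"
    by auto
  then have "card ?P = Suc (card J)"
    using assms(2) inj by (simp add: card_image)
  then have "OPT V E (Suc (card J)) \<le> partition_cost E ?P"
    using OPT_le_partition_cost assms(1) part by blast
  also have "\<dots> \<le> size (filter_mset (\<lambda>e. meets_two X J e \<or> cuts V (\<Union>(X ` J)) e) E)"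
    unfolding partition_cost_def
  proof (intro size_mset_mono filter_mset_mono_strong subset_mset.order_refl)
    fix e
    assume "\<exists>p\<in>?P. \<exists>q\<in>?P. p \<noteq> q \<and> e \<inter> p \<noteq> {} \<and> e \<inter> q \<noteq> {}"
    then obtain p q where pq: "p \<in> ?P" "q \<in> ?P" "p \<noteq> q" "e \<inter> p \<noteq> {}" "e \<inter> q \<noteq> {}"
      by (elim bexE conjE)
    have hit: "e \<inter> \<Union>(X ` J) \<noteq> {}" if "r \<in> ?P" "r \<noteq> ?R" "e \<inter> r \<noteq> {}" for r
    proof -
      have "r \<subseteq> \<Union>(X ` J)"
        using that(1,2) by auto
      then show ?thesis
        using that(3) by blast
    qed
    show "meets_two X J e \<or> cuts V (\<Union>(X ` J)) e"
    proof (cases "p = ?R \<or> q = ?R")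
      case True
      then show ?thesis
        using pq hit[of p] hit[of q] unfolding cuts_def by metis
    next
      case False
      then obtain i j where "i \<in> J" "j \<in> J" "p = X i" "q = X j"
        using pq(1,2) by auto
      then show ?thesis
        using pq(3-5) unfolding meets_two_def by metis
    qed
  qed
  finally show ?thesis .
qed

text \<open>A hyperedge charged by both groups meets a class of each; these are distinct members of
  the family, so it is heavy and pays twice. One charged by a single group is at least
  crossing.\<close>

lemma OPT_groups_le_weight:
  assumes "hypergraph V E" "disjoint_family_on X (I \<union> J)" "finite I" "finite J" "I \<inter> J = {}" "card I = card J"
    and X: "\<And>i. i \<in> I \<union> J \<Longrightarrow> X i \<subseteq> V \<and> X i \<noteq> {} \<and> X i \<inter> Z = {}"
    and Z: "Z \<subseteq> V" "Z \<noteq> {}"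
  shows "2 * OPT V E (Suc (card I)) \<le> (\<Sum>e\<in>#E. weight V X (I \<union> J) Z e)"
proof -
  let ?f = "\<lambda>J e. meets_two X J e \<or> cuts V (\<Union>(X ` J)) e"
  have opt: "OPT V E (Suc (card K)) \<le> (\<Sum>e\<in>#E. of_bool (?f K e))" if "K \<subseteq> I \<union> J" for K
    unfolding size_filter_mset_eq_sum[symmetric]
  proof (rule OPT_le_group_cost)
    show "finite V" "finite K" "disjoint_family_on X K"
      using assms that by (auto simp: hypergraph_def intro: finite_subset disjoint_family_on_mono)
    show "X i \<subseteq> V \<and> X i \<noteq> {}" if "i \<in> K" for i
      using X that \<open>K \<subseteq> I \<union> J\<close> by blast
    \<comment> \<open>The non-empty set \<open>Z\<close> is disjoint from every class.\<close>
    show "\<Union>(X ` K) \<noteq> V"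
      using X Z that by blast
  qed
  have "of_bool (?f I e) + of_bool (?f J e) \<le> weight V X (I \<union> J) Z e" if "e \<subseteq> V" for e
  proof -
    have meet: "e \<inter> \<Union>(X ` K) \<noteq> {}" if "?f K e" for K
      using that unfolding meets_two_def cuts_def by blast
    have both: "heavy V X (I \<union> J) Z e" if f: "?f I e" "?f J e"
    proof -
      obtain i j where "i \<in> I" "e \<inter> X i \<noteq> {}" "j \<in> J" "e \<inter> X j \<noteq> {}"
        using meet[OF f(1)] meet[OF f(2)] by blast
      moreover from this have "i \<noteq> j"
        using assms(5) by blast
      ultimately show ?thesis
        unfolding heavy_def meets_two_def by blast
    qed
    have one: "crossing V X (I \<union> J) Z e" if K: "?f K e" "K \<subseteq> I \<union> J" for K
    proof (cases "meets_two X (I \<union> J) e")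
      case True
      then show ?thesis
        by (simp add: crossing_def heavy_def)
    next
      case False
      then have "cuts V (\<Union>(X ` K)) e"
        using K unfolding meets_two_def by blast
      then obtain i v where i: "i \<in> K" "e \<inter> X i \<noteq> {}" and v: "v \<in> e" "v \<in> V" "v \<notin> \<Union>(X ` K)"
        unfolding cuts_def by blast
      \<comment> \<open>A vertex of \<open>e\<close> outside the group may not lie in a class of the
        other group, as \<open>e\<close> would then meet two classes; so it lies outside all of
        them.\<close>
      have "v \<notin> X j" if j: "j \<in> I \<union> J" for j
      proof
        assume vj: "v \<in> X j"
        have "i \<in> I \<union> J" "i \<noteq> j" "e \<inter> X j \<noteq> {}"
          using i(1) K(2) v vj by auto
        then show False
          using False i(2) j unfolding meets_two_def by metis
      qed
      then have "e \<inter> (V - \<Union>(X ` (I \<union> J))) \<noteq> {}"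
        using v(1,2) by blast
      moreover have "e \<inter> \<Union>(X ` (I \<union> J)) \<noteq> {}"
        using i K(2) by blast
      ultimately show ?thesis
        unfolding crossing_def by blast
    qed
    show ?thesis
      using both one[of I] one[of J] by (auto simp: weight_def crossing_def)
  qed
  then have "(\<Sum>e\<in>#E. of_bool (?f I e) + of_bool (?f J e)) \<le> (\<Sum>e\<in>#E. weight V X (I \<union> J) Z e)"
    using assms(1) by (intro sum_mset_mono) (auto simp: hypergraph_def)
  then show ?thesis
    using opt[of I] opt[of J] assms(6) by (simp add: sum_mset.distrib)
qed

section \<open>Bounding a smallest terminal set\<close>

theorem theorem5p1:
  fixes V :: "'a set" and E :: "'a set multiset" and k :: nat and U :: "'a set"
  assumes "hypergraph V E"
    and "k \<ge> 2" and "k \<le> card V"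
    and "U \<subseteq> V" and "U \<noteq> {}" and "U \<noteq> V"
    and "cut_value V E U \<le> OPT V E k"
  shows "\<exists>S. S \<subseteq> U \<and> card S \<le> 2 * k - 2 \<and>
             source_max_min_terminal_cut V E S (V - U) U"
proof -
  define c where "c = cut_value V E U"
  \<comment> \<open>The sources of \<open>(S, V - U)\<close>-terminal cuts are the sets between
    \<open>S\<close> and \<open>U\<close>, so \<open>good S\<close> says that \<open>U\<close> is a
    minimum one.\<close>
  define good where "good S \<longleftrightarrow> S \<subseteq> U \<and> (\<forall>Y. S \<subseteq> Y \<and> Y \<subseteq> U \<longrightarrow> c \<le> cut_value V E Y)" for S
  have finU: "finite U"
    using assms(1,4) by (auto simp: hypergraph_def intro: finite_subset)
  have "good U"
    by (auto simp: good_def c_def)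
  then obtain S where S: "good S" and Smin: "\<And>S'. good S' \<Longrightarrow> card S \<le> card S'"
    using ex_has_least_nat[of good U card] by blast
  have SU: "S \<subseteq> U" and finS: "finite S"
    using S finU by (auto simp: good_def intro: finite_subset)
  have "card S \<le> 2 * k - 2"
  proof (rule ccontr)
    assume "\<not> ?thesis"
    then obtain I where I: "I \<subseteq> S" "card I = 2 * k - 2" "finite I"
      using obtain_subset_with_card_n[of "2 * k - 2" S] by auto
    have "k - 1 \<le> card I"
      using I assms(2) by simp
    then obtain I1 where I1: "I1 \<subseteq> I" "card I1 = k - 1" "finite I1"
      using obtain_subset_with_card_n by metis
    \<comment> \<open>The witness is the complement of a cheaper source \<open>Y\<close> that
      appears once \<open>s\<close> is dropped; \<open>Y\<close> misses \<open>s\<close>, since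
      otherwise it would refute \<open>good S\<close>.\<close>
    have "\<exists>A. V - U \<subseteq> A \<and> A \<subseteq> V \<and> A \<inter> S = {s} \<and> cut_value V E A < c" if "s \<in> S" for s
    proof -
      have "\<not> good (S - {s})"
        using Smin[of "S - {s}"] finS that by (metis card_Diff1_less linorder_not_less)
      then obtain Y where Y: "S - {s} \<subseteq> Y" "Y \<subseteq> U" "cut_value V E Y < c"
        using SU by (auto simp: good_def not_le)
      moreover have "s \<notin> Y"
        using S Y unfolding good_def by (metis insert_Diff insert_subset leD that)
      ultimately show ?thesis
        using SU assms(4) that by (intro exI[of _ "V - Y"]) (auto simp: cut_value_compl)
    qed
    then obtain A where A: "\<And>s. s \<in> S \<Longrightarrow>
        V - U \<subseteq> A s \<and> A s \<subseteq> V \<and> A s \<inter> S = {s} \<and> cut_value V E (A s) < c"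
      by metis
    have min: "c \<le> cut_value V E D" if D: "V - U \<subseteq> D" "D \<subseteq> V" "D \<inter> S = {}" for D
    proof -
      have "S \<subseteq> V - D" "V - D \<subseteq> U"
        using D SU assms(4) by auto
      then show ?thesis
        using S D(2) unfolding good_def by (metis cut_value_compl)
    qed
    have TS: "(V - U) \<inter> S = {}" and cT: "c = cut_value V E (V - U)"
      using SU assms(4) by (auto simp: c_def cut_value_compl)
    have AI: "V - U \<subseteq> A s \<and> A s \<subseteq> V \<and> A s \<inter> S = {s} \<and> cut_value V E (A s) < c" if "s \<in> I" for s
      using A I(1) that by blast
    obtain X Z where Z: "V - U \<subseteq> Z" "Z \<subseteq> V" "Z \<inter> S = {}"
      and X: "\<forall>i\<in>I. X i \<subseteq> V \<and> X i \<inter> S = {i} \<and> X i \<inter> Z = {}"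
      and dis: "disjoint_family_on X I"
      and w: "(\<Sum>e\<in>#E. weight V X I Z e) + card I \<le> 2 * c"
      using uncross_family[OF I(3) assms(1) Diff_subset I(1) TS AI min cT] by blast
    have I_eq: "I = I1 \<union> (I - I1)" and "card (I - I1) = k - 1"
      using I I1 assms(2) by (auto simp: card_Diff_subset)
    have "2 * OPT V E (Suc (card I1)) \<le> (\<Sum>e\<in>#E. weight V X (I1 \<union> (I - I1)) Z e)"
    proof (rule OPT_groups_le_weight)
      show "disjoint_family_on X (I1 \<union> (I - I1))"
        using dis I_eq by simp
      show "finite (I - I1)" "card I1 = card (I - I1)"
        using I(3) I1(2) \<open>card (I - I1) = k - 1\<close> by simp_all
      show "X i \<subseteq> V \<and> X i \<noteq> {} \<and> X i \<inter> Z = {}" if "i \<in> I1 \<union> (I - I1)" for i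
        using X that I1(1) by blast
      show "Z \<noteq> {}"
        using Z(1) assms(4,6) by blast
    qed (use assms(1) I1(3) Z(2) in auto)
    then have "2 * OPT V E k + card I \<le> 2 * c"
      using w I1 assms(2) I_eq by simp
    \<comment> \<open>The strictness comes from \<open>card I = 2 * k - 2\<close>, positive as
      \<open>k \<ge> 2\<close>.\<close>
    then show False
      using assms(2,7) I(2) by (simp add: c_def)
  qed
  \<comment> \<open>Source maximality is automatic: every competing source avoids
    \<open>V - U\<close> and so lies in \<open>U\<close>.\<close>
  moreover have "source_max_min_terminal_cut V E S (V - U) U"
    using S assms(4)
    by (auto simp: source_max_min_terminal_cut_def min_terminal_cut_def terminal_cut_def
        good_def c_def double_diff)
  ultimately show ?thesis
    using SU by blast
qed

end
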